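(* Let $G$ be a graph that has a $\{K_{1,1}, K_{1,2}, C_m : m\ge 3\}$-factor, and let $e=uv \in E(G)$. There is no $\{K_{1,1}, K_{1,2}, C_m : m\ge 3\}$-factor of $G$ which contains $e$ if and only if there is a subset $S$ of $V(G)$ that satisfies (i) $u,v\in S$, and (ii) $2|S| -2\le \mathrm{iso}(G-S) \le 2|S|$. Furthermore, the inequalities of (ii) are tight, i.e. for each of the two inequalities there exist such a graph $G$, an edge $e=uv$ contained in no $\{K_{1,1}, K_{1,2}, C_m : m\ge 3\}$-factor of $G$, and a set $S$ satisfying (i) and (ii) for which that inequality holds with equality.
   Context: All graphs are finite and simple. $K_{1,i}$ is the star with $i$ edges and $C_m$ is the circuit (connected 2-regular graph) on $m$ vertices. A $\{K_{1,1}, K_{1,2}, C_m : m\ge 3\}$-factor of $G$ is a spanning subgraph each of whose components is isomorphic to $K_{1,1}$, $K_{1,2}$, or $C_m$ for some $m\ge 3$; it contains $e$ if $e$ is one of its edges. $G-S$ is the subgraph induced by $V(G)\setminus S$, and $\mathrm{iso}(H)$ is the number of isolated vertices (components consisting of a single vertex) of a graph $H$. *)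

theory Defs
  imports "Graph_Theory.Graph_Theory"
begin

text \<open>
  Finite simple graphs are the symmetric, loop-free digraphs without parallel arcs of the library
  (locale \<^locale>\<open>graph\<close>): an undirected edge \<open>uv\<close> is the pair of arcs from \<open>u\<close> to \<open>v\<close> and back,
  so \<open>uv\<close> is an edge of \<open>G\<close> iff \<open>u \<rightarrow>\<^bsub>G\<^esub> v\<close>. Stars are the \<open>K\<^bsub>1,i\<^esub>\<close> of the library, which is a
  predicate closed under isomorphism.
\<close>

definition component :: "('a,'b) pre_digraph \<Rightarrow> ('a,'b) pre_digraph \<Rightarrow> bool" where
  "component C G \<longleftrightarrow> pre_digraph.max_subgraph G Digraph_Component.connected C"

text \<open>In a symmetric digraph the out-degree of a vertex is its degree in the undirected graph.\<close>

definition circuit :: "nat \<Rightarrow> ('a,'b) pre_digraph \<Rightarrow> bool" where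
  "circuit m C \<longleftrightarrow> graph C \<and> Digraph_Component.connected C \<and>
     (\<forall>v \<in> verts C. out_degree C v = 2) \<and> card (verts C) = m"

text \<open>A \<open>{K\<^bsub>1,1\<^esub>, K\<^bsub>1,2\<^esub>, C\<^sub>m : m \<ge> 3}\<close>-factor; \<open>graph F\<close> makes \<open>F\<close> contain both arcs of each of its edges.\<close>

definition star_circuit_factor :: "('a,'b) pre_digraph \<Rightarrow> ('a,'b) pre_digraph \<Rightarrow> bool" where
  "star_circuit_factor F G \<longleftrightarrow> graph F \<and> spanning F G \<and>
     (\<forall>C. component C F \<longrightarrow> K\<^bsub>1,1\<^esub> C \<or> K\<^bsub>1,2\<^esub> C \<or> (\<exists>m\<ge>3. circuit m C))"

definition remove_verts :: "('a,'b) pre_digraph \<Rightarrow> 'a set \<Rightarrow> ('a,'b) pre_digraph" where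
  "remove_verts G S = G \<restriction> (verts G - S)"

definition num_isolated :: "('a,'b) pre_digraph \<Rightarrow> nat" where
  "num_isolated H = card {v. \<exists>C. component C H \<and> verts C = {v}}"

lemma graph_isolated_iff:
  assumes "graph H"
  shows "(\<exists>C. component C H \<and> verts C = {v}) \<longleftrightarrow> v \<in> verts H \<and> (\<forall>w. \<not> v \<rightarrow>\<^bsub>H\<^esub> w)"
proof -
  interpret graph H by fact
  have sc: "Digraph_Component.connected D" if "strongly_connected D"
    for D :: "('a,'b) pre_digraph"
    using that unfolding connected_conv strongly_connected_def reachable_def symcl_def
    by (auto intro: rtrancl_on_mono)
  show ?thesis
  proof (intro iffI conjI allI notI)
    assume "\<exists>C. component C H \<and> verts C = {v}"
    then obtain C where C: "pre_digraph.max_subgraph H Digraph_Component.connected C"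
        and vC: "verts C = {v}"
      unfolding component_def by blast
    have sub: "subgraph C H" using C by (rule subgraphI_max_subgraph)
    show "v \<in> verts H" using sub vC unfolding subgraph_def by auto
    fix w assume vw: "v \<rightarrow>\<^bsub>H\<^esub> w"
    then have wv: "w \<rightarrow>\<^bsub>H\<^esub> v" by (rule graph_symmetric)
    have ne: "v \<noteq> w" using vw no_loops by (auto simp: arcs_ends_conv)
    have inV: "v \<in> verts H" "w \<in> verts H" using vw by (auto simp: arcs_ends_conv)
    let ?D = "H \<restriction> {v,w}"
    have subD: "subgraph ?D H" using inV by (intro induced_imp_subgraph induced_induce) auto
    have wfD: "wf_digraph ?D" using subD unfolding subgraph_def by blast
    have wfC: "wf_digraph C" and aC: "arcs C \<subseteq> arcs H" and ct: "tail C = tail H" "head C = head H"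
      using sub unfolding subgraph_def compatible_def by auto
    have "tail H a \<in> {v} \<and> head H a \<in> {v}" if "a \<in> arcs C" for a
      using wf_digraph.tail_in_verts[OF wfC that] wf_digraph.head_in_verts[OF wfC that] vC ct
      by auto
    then have "subgraph C ?D"
      using wfC wfD aC ct vC unfolding subgraph_def compatible_def by auto
    moreover have "?D \<noteq> C"
    proof
      assume "?D = C"
      then have "verts ?D = verts C" by simp
      then show False using ne vC by auto
    qed
    moreover have "Digraph_Component.connected ?D"
    proof -
      have d: "v \<rightarrow>\<^bsub>?D\<^esub> w" "w \<rightarrow>\<^bsub>?D\<^esub> v"
        using vw wv by (auto simp: arcs_ends_conv)
      have "strongly_connected ?D"
        unfolding strongly_connected_def
        using wf_digraph.reachable_adjI[OF wfD d(1)] wf_digraph.reachable_adjI[OF wfD d(2)]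
        by (auto intro: wf_digraph.reachable_refl[OF wfD])
      then show ?thesis by (rule sc)
    qed
    ultimately show False using C subD unfolding max_subgraph_def by blast
  next
    assume v: "v \<in> verts H \<and> (\<forall>w. \<not> v \<rightarrow>\<^bsub>H\<^esub> w)"
    then have noin: "\<not> w \<rightarrow>\<^bsub>H\<^esub> v" for w using graph_symmetric by blast
    let ?C = "H \<restriction> {v}"
    have subC: "subgraph ?C H" using v by (intro induced_imp_subgraph induced_induce) auto
    then have wfC: "wf_digraph ?C" unfolding subgraph_def by blast
    have "strongly_connected ?C"
      unfolding strongly_connected_def by (auto intro: wf_digraph.reachable_refl[OF wfC])
    then have conC: "Digraph_Component.connected ?C"
      by (rule sc)
    have "\<not> Digraph_Component.connected D"
      if D: "?C \<noteq> D" "subgraph ?C D" "subgraph D H" for D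
    proof
      assume con: "Digraph_Component.connected D"
      have ends: "arcs_ends D \<subseteq> arcs_ends H"
        using D(3) unfolding subgraph_def compatible_def arcs_ends_conv by auto
      have vD: "v \<in> verts D" using D(2) unfolding subgraph_def by auto
      have "w = v" if w: "w \<in> verts D" for w
      proof (rule ccontr)
        assume "w \<noteq> v"
        have "(v,w) \<in> rtrancl_on (verts D) ((arcs_ends D)\<^sup>s)"
          using con vD w unfolding connected_conv by blast
        then have "(v,w) \<in> ((arcs_ends D)\<^sup>s)\<^sup>*" by (rule rtrancl_on_rtranclI)
        then obtain x where "(v,x) \<in> (arcs_ends D)\<^sup>s"
          using \<open>w \<noteq> v\<close> by (blast elim: converse_rtranclE)
        then show False using ends v noin unfolding symcl_def by auto
      qed
      then have vsD: "verts D = {v}" using vD by blast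
      have "arcs D = {}"
      proof (rule ccontr)
        assume "arcs D \<noteq> {}"
        then obtain a where a: "a \<in> arcs D" by blast
        then have "(tail D a, head D a) \<in> arcs_ends H" using ends by (auto simp: arcs_ends_conv)
        moreover have "tail D a = v"
          using a D(3) vsD wf_digraph.tail_in_verts[of D a] unfolding subgraph_def by auto
        ultimately show False using v by auto
      qed
      moreover have "arcs ?C \<subseteq> arcs D" using D(2) unfolding subgraph_def by blast
      moreover have "tail D = tail H" "head D = head H"
        using D(3) unfolding subgraph_def compatible_def by auto
      ultimately have "?C = D" using vsD by (intro pre_digraph.equality) auto
      then show False using D(1) by blast
    qed
    then have "pre_digraph.max_subgraph H Digraph_Component.connected ?C"
      using conC subC by (intro max_subgraphI) auto
    then show "\<exists>C. component C H \<and> verts C = {v}"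
      unfolding component_def by (intro exI[of _ ?C]) simp
  qed
qed

end

theory Submission
  imports Defs
begin

text \<open>
  Circuits play no role for the obstruction: a circuit splits into paths on two or three vertices,
  one of which contains a prescribed edge. So a factor containing \<open>uv\<close> exists iff \<open>G\<close> can
  be partitioned into stars with one or two leaves, one of which uses \<open>uv\<close>. Redraw \<open>u\<close> as a hub
  that sees every vertex adjacent to \<open>u\<close> or to \<open>v\<close>, and \<open>v\<close> as a pendant vertex attached to \<open>u\<close>:
  the star partitions of the new graph are those of \<open>G\<close> using \<open>uv\<close>, up to moving the centre
  between \<open>u\<close> and \<open>v\<close>. The criterion \<open>iso (G - S) \<le> 2 |S|\<close> for the new graph is the condition sought.

  The criterion itself comes from Hall's theorem with capacities 2. It provides a map \<open>g\<close> with
  \<open>g v\<close> adjacent to \<open>v\<close> and fibres of size at most 2, and the functional graph of \<open>g\<close> can be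
  dismantled star by star. Conversely, in a factor every degree is 1 or 2, so counting the factor
  edges between \<open>S\<close> and the isolated vertices of \<open>G - S\<close> bounds the number of the latter.
\<close>

section \<open>Hall's theorem\<close>

text \<open>Induction on the number of indices. If every nonempty proper subfamily has an element to
  spare, any choice for one index preserves the condition; otherwise a tight subfamily is matched
  within its union and the rest outside it.\<close>

lemma hall_marriage:
  fixes A :: "'i \<Rightarrow> 'b set"
  assumes "finite I" "\<And>i. i \<in> I \<Longrightarrow> finite (A i)"
    and "\<And>J. J \<subseteq> I \<Longrightarrow> card J \<le> card (\<Union>(A ` J))"
  shows "\<exists>f. inj_on f I \<and> (\<forall>i\<in>I. f i \<in> A i)"
  using assms
proof (induction "card I" arbitrary: I A rule: less_induct)
  case less
  note finI = less.prems(1) and finA = less.prems(2) and hall = less.prems(3)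
  consider "I = {}" | (strict) "I \<noteq> {}" "\<And>J. J \<subset> I \<Longrightarrow> J \<noteq> {} \<Longrightarrow> card J < card (\<Union>(A ` J))"
    | (tight) J where "J \<subset> I" "J \<noteq> {}" "card J = card (\<Union>(A ` J))"
    using hall by (metis nat_less_le psubset_imp_subset)
  then show ?case
  proof cases
    case 1
    then show ?thesis by simp
  next
    case strict
    then obtain i where i: "i \<in> I" by blast
    have "card {i} \<le> card (\<Union>(A ` {i}))" using hall i by blast
    then obtain a where a: "a \<in> A i" by fastforce
    let ?B = "\<lambda>j. A j - {a}"
    have "\<exists>f. inj_on f (I - {i}) \<and> (\<forall>j\<in>I - {i}. f j \<in> ?B j)"
    proof (rule less.hyps)
      show "card (I - {i}) < card I" using i finI by (meson card_Diff1_less)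
      show "finite (I - {i})" using finI by simp
      show "finite (?B j)" if "j \<in> I - {i}" for j using finA that by simp
      show "card J \<le> card (\<Union>(?B ` J))" if J: "J \<subseteq> I - {i}" for J
      proof (cases "J = {}")
        case False
        have "J \<subset> I" using J i by blast
        then have "card J < card (\<Union>(A ` J))" using strict(2) False by blast
        moreover have "\<Union>(?B ` J) = \<Union>(A ` J) - {a}" by blast
        ultimately show ?thesis by (auto simp: card_Diff_singleton_if)
      qed simp
    qed
    then obtain f where f: "inj_on f (I - {i})" "\<And>j. j \<in> I - {i} \<Longrightarrow> f j \<in> ?B j" by blast
    have "inj_on (f(i := a)) I" using f by (auto simp: inj_on_def)
    moreover have "\<forall>j\<in>I. (f(i := a)) j \<in> A j" using f a by auto
    ultimately show ?thesis by blast
  next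
    case tight
    let ?T = "\<Union>(A ` J)"
    let ?B = "\<lambda>j. A j - ?T"
    have JI: "J \<subseteq> I" and finJ: "finite J" using tight finI by (auto intro: finite_subset)
    have "\<exists>f. inj_on f J \<and> (\<forall>j\<in>J. f j \<in> A j)"
    proof (rule less.hyps)
      show "card J < card I" by (rule psubset_card_mono[OF finI tight(1)])
    qed (use JI finJ finA hall in blast)+
    then obtain f where f: "inj_on f J" "\<And>j. j \<in> J \<Longrightarrow> f j \<in> A j" by blast
    have "\<exists>g. inj_on g (I - J) \<and> (\<forall>j\<in>I - J. g j \<in> ?B j)"
    proof (rule less.hyps)
      show "card (I - J) < card I" using tight finI by (intro psubset_card_mono) auto
      show "card K \<le> card (\<Union>(?B ` K))" if K: "K \<subseteq> I - J" for K
      proof -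
        have finK: "finite K" using K finI by (auto intro: finite_subset)
        \<comment> \<open>Hall's condition for \<open>K \<union> J\<close>, less the tight equality
          for \<open>J\<close>, is Hall's condition for \<open>K\<close> outside
          \<open>?T\<close>.\<close>
        have "card K + card J = card (K \<union> J)"
          using K finK finJ by (subst card_Un_disjoint) auto
        also have "\<dots> \<le> card (\<Union>(A ` (K \<union> J)))" using K JI by (intro hall) auto
        also have "\<Union>(A ` (K \<union> J)) = \<Union>(?B ` K) \<union> ?T" by blast
        also have "card \<dots> \<le> card (\<Union>(?B ` K)) + card ?T" by (rule card_Un_le)
        finally show ?thesis using tight by simp
      qed
    qed (use finI finA in auto)
    then obtain g where g: "inj_on g (I - J)" "\<And>j. j \<in> I - J \<Longrightarrow> g j \<in> ?B j" by blast
    let ?h = "\<lambda>i. if i \<in> J then f i else g i"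
    have "f i \<noteq> g j" if "i \<in> J" "j \<in> I - J" for i j using f(2)[OF that(1)] g(2)[OF that(2)] that by auto
    then have "inj_on ?h I" using f(1) g(1) unfolding inj_on_def by (metis DiffI)
    moreover have "\<forall>i\<in>I. ?h i \<in> A i" using f(2) g(2) by auto
    ultimately show ?thesis by blast
  qed
qed

text \<open>Giving each value \<open>b\<close> the \<open>k\<close> copies \<open>(b, c)\<close>
  with \<open>c < k\<close> reduces capacities to injectivity; \<open>fst\<close> forgets the
  copy.\<close>

lemma hall_marriage_capacity:
  fixes A :: "'i \<Rightarrow> 'b set"
  assumes "finite I" "\<And>i. i \<in> I \<Longrightarrow> finite (A i)"
    and hall: "\<And>J. J \<subseteq> I \<Longrightarrow> card J \<le> k * card (\<Union>(A ` J))"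
  shows "\<exists>f. (\<forall>i\<in>I. f i \<in> A i) \<and> (\<forall>b. card {i \<in> I. f i = b} \<le> k)"
proof -
  let ?B = "\<lambda>i. A i \<times> {..<k}"
  have "\<exists>f. inj_on f I \<and> (\<forall>i\<in>I. f i \<in> ?B i)"
  proof (rule hall_marriage)
    show "card J \<le> card (\<Union>(?B ` J))" if "J \<subseteq> I" for J
    proof -
      have "\<Union>(?B ` J) = \<Union>(A ` J) \<times> {..<k}" by blast
      then show ?thesis using hall[OF that] by (simp add: card_cartesian_product mult.commute)
    qed
  qed (use assms in auto)
  then obtain f where f: "inj_on f I" "\<And>i. i \<in> I \<Longrightarrow> f i \<in> ?B i" by blast
  have "card {i \<in> I. fst (f i) = b} \<le> k" for b
  proof -
    have "inj_on f {i \<in> I. fst (f i) = b}" using f(1) by (auto simp: inj_on_def)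
    moreover have "f ` {i \<in> I. fst (f i) = b} \<subseteq> {b} \<times> {..<k}" using f(2) by force
    ultimately have "card {i \<in> I. fst (f i) = b} \<le> card ({b} \<times> {..<k})"
      by (intro card_inj_on_le) auto
    then show ?thesis by simp
  qed
  moreover have "\<forall>i\<in>I. fst (f i) \<in> A i" using f(2) by (auto simp: mem_Times_iff)
  ultimately show ?thesis by (intro exI[of _ "fst \<circ> f"]) simp
qed

section \<open>Partitions into stars\<close>

text \<open>
  \<open>h\<close> maps each vertex to the centre of its star; a star on two vertices has either end as centre.
\<close>

definition star_partition :: "'a set \<Rightarrow> ('a \<Rightarrow> 'a \<Rightarrow> bool) \<Rightarrow> ('a \<Rightarrow> 'a) \<Rightarrow> bool" where
  "star_partition V E h \<longleftrightarrow> (\<forall>v\<in>V. h v \<in> V \<and> h (h v) = h v \<and> (h v \<noteq> v \<longrightarrow> E (h v) v) \<and>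
     card {w \<in> V. h w = h v} \<in> {2, 3})"

section \<open>Dismantling the graph of a map into stars\<close>

lemma star_partition_extend:
  assumes h: "star_partition (V - X) E h" and X: "X \<subseteq> V" "c \<in> X" "card X \<in> {2, 3}"
    and c: "\<And>x. x \<in> X \<Longrightarrow> x \<noteq> c \<Longrightarrow> E c x"
  shows "\<exists>h. star_partition V E h"
proof -
  let ?h = "\<lambda>v. if v \<in> X then c else h v"
  have 1: "{w \<in> V. ?h w = c} = X"
    using X h unfolding star_partition_def by auto
  have 2: "{w \<in> V. ?h w = h v} = {w \<in> V - X. h w = h v}" if "v \<in> V - X" for v
    using X h that unfolding star_partition_def by auto
  have "star_partition V E ?h" unfolding star_partition_def
  proof (intro ballI)
    fix v assume v: "v \<in> V"
    show "?h v \<in> V \<and> ?h (?h v) = ?h v \<and> (?h v \<noteq> v \<longrightarrow> E (?h v) v) \<and> card {w \<in> V. ?h w = ?h v} \<in> {2, 3}"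
    proof (cases "v \<in> X")
      case True
      then show ?thesis using X c 1 by auto
    next
      case False
      then have "v \<in> V - X" using v by simp
      then show ?thesis using h 2[of v] False unfolding star_partition_def by auto
    qed
  qed
  then show ?thesis by blast
qed

text \<open>Induction on the number of vertices: a star is split off so that the rest again carries
  such a map, with \<open>g\<close> changed at no more than one vertex.\<close>

lemma star_partition_of_functional_graph:
  fixes g :: "'a \<Rightarrow> 'a"
  assumes "finite V" and sym: "\<And>x y. E x y \<Longrightarrow> E y x" and irr: "\<And>x. \<not> E x x"
    and "\<And>v. v \<in> V \<Longrightarrow> g v \<in> V \<and> E v (g v)" and "\<And>c. card {v \<in> V. g v = c} \<le> 2"
  shows "\<exists>h. star_partition V E h"
  using assms(1,4,5)
proof (induction "card V" arbitrary: V g rule: less_induct)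
  case less
  note finV = less.prems(1) and g = less.prems(2) and fib = less.prems(3)
  have gV: "g v \<in> V" and gE: "E v (g v)" "E (g v) v" and gne: "g v \<noteq> v" if "v \<in> V" for v
    using g[OF that] sym irr by metis+
  \<comment> \<open>The inductive step: \<open>X\<close> is the star split off and \<open>g'\<close>
    a map for the rest.\<close>
  have remove: "\<exists>h. star_partition V E h"
    if X: "X \<subseteq> V" "c \<in> X" "card X \<in> {2, 3}" "\<And>x. x \<in> X \<Longrightarrow> x \<noteq> c \<Longrightarrow> E c x"
      and g': "\<And>v. v \<in> V - X \<Longrightarrow> g' v \<in> V - X \<and> E v (g' v)"
      and fib': "\<And>b. card {v \<in> V - X. g' v = b} \<le> 2" for X c g'
  proof -
    have "card (V - X) < card V" using X finV by (intro psubset_card_mono) auto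
    then have "\<exists>h. star_partition (V - X) E h"
      using g' fib' finV by (intro less.hyps[of "V - X" g']) auto
    then show ?thesis using star_partition_extend[of V X E _ c] X by blast
  qed
  \<comment> \<open>If \<open>g\<close> sends nothing from outside \<open>X\<close> into
    \<open>X\<close>, then \<open>g\<close> itself serves the rest.\<close>
  have keep: "\<exists>h. star_partition V E h"
    if X: "X \<subseteq> V" "c \<in> X" "card X \<in> {2, 3}" "\<And>x. x \<in> X \<Longrightarrow> x \<noteq> c \<Longrightarrow> E c x"
      and closed: "\<And>v. v \<in> V - X \<Longrightarrow> g v \<notin> X" for X c
  proof (rule remove[OF X])
    show "g v \<in> V - X \<and> E v (g v)" if "v \<in> V - X" for v using that closed gV gE by blast
    show "card {v \<in> V - X. g v = b} \<le> 2" for b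
    proof -
      have "card {v \<in> V - X. g v = b} \<le> card {v \<in> V. g v = b}"
        using finV by (intro card_mono) auto
      then show ?thesis using fib[of b] by linarith
    qed
  qed simp
  \<comment> \<open>Only \<open>q\<close> may lose its image; it is sent to its neighbour
    \<open>t\<close>. By \<open>once\<close>, \<open>t\<close> has at most one other preimage left,
    so the fibre bound 2 survives.\<close>
  have redirect: "\<exists>h. star_partition V E h"
    if X: "X \<subseteq> V" "c \<in> X" "card X \<in> {2, 3}" "\<And>x. x \<in> X \<Longrightarrow> x \<noteq> c \<Longrightarrow> E c x"
      and closed: "\<And>v. v \<in> V - X \<Longrightarrow> v \<noteq> q \<Longrightarrow> g v \<notin> X"
      and t: "t \<in> V - X" "E q t"
      and once: "\<And>v w. v \<in> V - X \<Longrightarrow> w \<in> V - X \<Longrightarrow> v \<noteq> q \<Longrightarrow> w \<noteq> q \<Longrightarrow> g v = t \<Longrightarrow> g w = t \<Longrightarrow> v = w"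
    for X c q t
  proof (rule remove[OF X])
    show "(g(q := t)) v \<in> V - X \<and> E v ((g(q := t)) v)" if "v \<in> V - X" for v
      using that closed t gV gE by auto
    show "card {v \<in> V - X. (g(q := t)) v = b} \<le> 2" for b
    proof (cases "b = t")
      case True
      obtain s where "{v \<in> V - X. (g(q := t)) v = b} \<subseteq> {q, s}"
      proof (cases "\<exists>s \<in> V - X. s \<noteq> q \<and> g s = t")
        case True
        then obtain s where s: "s \<in> V - X" "s \<noteq> q" "g s = t" by blast
        show ?thesis
        proof (rule that, rule subsetI)
          fix v assume "v \<in> {v \<in> V - X. (g(q := t)) v = b}"
          then show "v \<in> {q, s}" using once[of v s] s \<open>b = t\<close> by (cases "v = q") auto
        qed
      next
        case False
        then show ?thesis using \<open>b = t\<close> by (intro that[of q]) auto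
      qed
      then have "card {v \<in> V - X. (g(q := t)) v = b} \<le> card {q, s}" by (intro card_mono) auto
      also have "\<dots> \<le> 2" by (simp add: card_insert_if)
      finally show ?thesis .
    next
      case False
      then have "{v \<in> V - X. (g(q := t)) v = b} \<subseteq> {v \<in> V. g v = b}" by auto
      then have "card {v \<in> V - X. (g(q := t)) v = b} \<le> card {v \<in> V. g v = b}"
        using finV by (intro card_mono) auto
      then show ?thesis using fib[of b] by linarith
    qed
  qed simp
  \<comment> \<open>If some star of leaves around a vertex is closed under preimages, remove it. Otherwise \<open>g\<close>
    permutes its image and every vertex carries at most one leaf; cut a cycle next to a leaf, or
    anywhere if there is none, and redirect the vertex that loses its image.\<close>
  let ?N = "g ` V"
  show ?case
  proof (cases "\<exists>p \<in> ?N. \<forall>v \<in> V. g v = p \<longrightarrow> v \<notin> ?N")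
    case True
    then obtain p where p: "p \<in> ?N" "\<And>v. v \<in> V \<Longrightarrow> g v = p \<Longrightarrow> v \<notin> ?N" by blast
    let ?L = "{v \<in> V. g v = p}"
    have "p \<in> V" "p \<notin> ?L" using p gV gne by auto
    have "?L \<noteq> {}" "finite ?L" using p finV by auto
    then have "card ?L = 1 \<or> card ?L = 2"
      using fib[of p] card_gt_0_iff[of ?L] by linarith
    then have "card (insert p ?L) \<in> {2, 3}"
      using card_insert_disjoint[OF \<open>finite ?L\<close> \<open>p \<notin> ?L\<close>] by auto
    moreover have "E p x" if "x \<in> ?L" for x using gE(2)[of x] that by auto
    moreover have "g v \<notin> insert p ?L" if "v \<in> V - insert p ?L" for v using that p by blast
    ultimately show ?thesis
      using \<open>p \<in> V\<close> by (intro keep[of "insert p ?L" p]) auto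
  next
    case False
    then have surj: "\<exists>q\<in>?N. g q = p" if "p \<in> ?N" for p using that by blast
    have "g ` ?N = ?N"
    proof
      show "g ` ?N \<subseteq> ?N" using gV by blast
      show "?N \<subseteq> g ` ?N"
      proof
        fix p assume "p \<in> ?N"
        then obtain q where "q \<in> ?N" "g q = p" using surj by blast
        then show "p \<in> g ` ?N" by (intro image_eqI[of p g q]) simp_all
      qed
    qed
    then have inj: "inj_on g ?N" using finV by (intro eq_card_imp_inj_on) auto
    show ?thesis
    proof (cases "V = {}")
      case True
      then show ?thesis unfolding star_partition_def by blast
    next
      case nonempty: False
      show ?thesis
      proof (cases "?N = V")
        case True
        then have inj: "x = y" if "x \<in> V" "y \<in> V" "g x = g y" for x y
          using inj that by (metis inj_onD)
        \<comment> \<open>Here \<open>g\<close> permutes \<open>V\<close>, and \<open>r\<close>,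
          \<open>q\<close>, \<open>p\<close>, \<open>g p\<close> are consecutive on a cycle.\<close>
        obtain p where p: "p \<in> V" using nonempty by blast
        obtain q where q: "q \<in> V" "g q = p" using surj p True by auto
        obtain r where r: "r \<in> V" "g r = q" using surj q True by auto
        have ne: "p \<noteq> q" "q \<noteq> r" using gne q r by auto
        have E: "E p q" "E q r" "E q p" "E p (g p)" using gE p q r by blast+
        have pre: "w = q" if "w \<in> V" "g w = p" for w using that inj q by blast
        have pre': "w = r" if "w \<in> V" "g w = q" for w using that inj r by blast
        have pre'': "w = p" if "w \<in> V" "g w = g p" for w using that inj p by blast
        \<comment> \<open>The cycle has length two, three or more. The first two kinds are removed
          whole, the triangle as a path with centre \<open>q\<close>. From a longer cycle the edge
          from \<open>p\<close> to \<open>g p\<close> is removed and \<open>q\<close> is sent back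
          to \<open>r\<close>.\<close>
        consider "r = p" | "r \<noteq> p" "g p = r" | "r \<noteq> p" "g p \<noteq> r" by blast
        then show ?thesis
        proof cases
          case 1
          have "g w \<notin> {p, q}" if "w \<in> V - {p, q}" for w using that pre pre' 1 by blast
          then show ?thesis using p q(1) ne E by (intro keep[of "{p, q}" p]) auto
        next
          case 2
          have "w = p" if "w \<in> V" "g w = r" for w using pre''[OF that(1)] that(2) 2(2) by simp
          then have "g w \<notin> {p, q, r}" if "w \<in> V - {p, q, r}" for w
            using that pre pre' by blast
          then show ?thesis using p q(1) r(1) ne E 2(1) by (intro keep[of "{p, q, r}" q]) auto
        next
          case 3
          have "g p \<noteq> q" using 3(1) pre'[OF p] by blast
          have "g w \<notin> {p, g p}" if "w \<in> V - {p, g p}" "w \<noteq> q" for w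
            using that pre pre'' by blast
          moreover have "r \<in> V - {p, g p}" using r 3 by simp
          moreover have "w = w'" if "w \<in> V" "w' \<in> V" "g w = r" "g w' = r" for w w'
            using inj that by simp
          moreover have "card {p, g p} = 2" using gne[OF p] by simp
          ultimately show ?thesis
            using p gV[OF p] E by (intro redirect[of "{p, g p}" p q r]) auto
        qed
      next
        case False
        \<comment> \<open>\<open>v\<close> is a leaf hanging at \<open>p\<close>, and
          \<open>r\<close>, \<open>q\<close>, \<open>p\<close> are consecutive on a cycle of
          \<open>g\<close>, with \<open>r = p\<close> if it has length two.\<close>
        then obtain v where v: "v \<in> V" "v \<notin> ?N" using gV by blast
        define p where "p = g v"
        have p: "p \<in> ?N" "p \<in> V" using v gV by (auto simp: p_def)
        obtain q where q: "q \<in> ?N" "g q = p" using surj p by blast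
        obtain r where r: "r \<in> ?N" "g r = q" using surj q by blast
        have qrV: "q \<in> V" "r \<in> V" using q r gV by auto
        have ne: "p \<noteq> q" "q \<noteq> r" "v \<noteq> p" "v \<noteq> q" "v \<noteq> r"
          using gne q r qrV v p by auto
        have E: "E p v" "E p q" "E q r" using gE[of v] gE[of q] gE[of r] v q r qrV by (auto simp: p_def)
        have above_p: "w = v \<or> w = q" if w: "w \<in> V" "g w = p" for w
        proof (rule ccontr)
          assume "\<not> ?thesis"
          then have "card {v, q, w} = 3" using ne by auto
          moreover have "card {v, q, w} \<le> card {x \<in> V. g x = p}"
            using w v q qrV finV by (intro card_mono) (auto simp: p_def)
          ultimately show False using fib[of p] by linarith
        qed
        have uniq: "w = s" if "w \<in> ?N" "s \<in> ?N" "g w = g s" for w s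
          using that inj by (metis inj_onD)
        have noleaf: "g w \<noteq> x" if "x \<notin> ?N" "w \<in> V" for w x using that by blast
        have gv: "g w \<noteq> v" if "w \<in> V" for w using that v by blast
        have "l = r" if "l \<in> ?N" "g l = q" for l using uniq[OF that(1) r(1)] that(2) r(2) by simp
        \<comment> \<open>A leaf of \<open>q\<close> becomes the new image of \<open>q\<close> once
          \<open>{p, v}\<close> is removed. Without one, \<open>{p, v, q}\<close> can go: nothing
          else enters it if the cycle has length two, and otherwise a leaf of \<open>r\<close>
          becomes the new image of \<open>r\<close>. If \<open>r\<close> has no leaf,
          \<open>{p, v}\<close> goes and \<open>q\<close> is sent back to \<open>r\<close>, whose
          fibre has room.\<close>
        then consider (q) l where "l \<in> V" "l \<notin> ?N" "g l = q"
          | (qp) "\<forall>l\<in>V. g l = q \<longrightarrow> l = r" "r = p"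
          | (r) l where "\<forall>l\<in>V. g l = q \<longrightarrow> l = r" "r \<noteq> p" "l \<in> V" "l \<notin> ?N" "g l = r"
          | (no) "r \<noteq> p" "\<forall>l\<in>V. g l = r \<longrightarrow> l \<in> ?N"
          by blast
        then show ?thesis
        proof cases
          case q
          have "g w \<notin> {p, v}" if "w \<in> V - {p, v}" "w \<noteq> q" for w
            using that above_p gv by blast
          moreover have "l \<in> V - {p, v}" using q p ne gv \<open>g q = p\<close> by (auto simp: p_def)
          moreover have "E q l" using gE[OF q(1)] q(3) by simp
          moreover have "g w \<noteq> l" if "w \<in> V" for w using that noleaf q by blast
          ultimately show ?thesis
            using ne E v(1) p(2) by (intro redirect[of "{p, v}" p q l]) auto
        next
          case qp
          have "g w \<notin> {p, v, q}" if "w \<in> V - {p, v, q}" for w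
            using that above_p gv qp by blast
          then show ?thesis
            using ne E v(1) p(2) qrV by (intro keep[of "{p, v, q}" p]) auto
        next
          case r
          have "g w \<notin> {p, v, q}" if "w \<in> V - {p, v, q}" "w \<noteq> r" for w
            using that above_p gv r(1) by blast
          moreover have "l \<in> V - {p, v, q}" using r p q v ne by (auto simp: p_def)
          moreover have "E r l" using gE[of l] r by simp
          moreover have "g w \<noteq> l" if "w \<in> V" for w using that noleaf r by blast
          ultimately show ?thesis
            using ne E v(1) p(2) qrV by (intro redirect[of "{p, v, q}" p r l]) auto
        next
          case no
          have "g w \<notin> {p, v}" if "w \<in> V - {p, v}" "w \<noteq> q" for w
            using that above_p gv by blast
          moreover have "r \<in> V - {p, v}" using no qrV ne by auto
          moreover have "w = w'" if "w \<in> V" "w' \<in> V" "g w = r" "g w' = r" for w w'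
            using that no(2) uniq[of w w'] by simp
          ultimately show ?thesis
            using ne E v(1) p(2) by (intro redirect[of "{p, v}" p q r]) auto
        qed
      qed
    qed
  qed
qed

section \<open>Existence of star partitions\<close>

abbreviation isolated_outside :: "'a set \<Rightarrow> ('a \<Rightarrow> 'a \<Rightarrow> bool) \<Rightarrow> 'a set \<Rightarrow> 'a set" where
  "isolated_outside V E S \<equiv> {v \<in> V - S. \<forall>w \<in> V - S. \<not> E v w}"

lemma star_partition_exists:
  assumes fin: "finite V" and sym: "\<And>x y. E x y \<Longrightarrow> E y x" and irr: "\<And>x. \<not> E x x"
    and iso: "\<And>S. S \<subseteq> V \<Longrightarrow> card (isolated_outside V E S) \<le> 2 * card S"
  shows "\<exists>h. star_partition V E h"
proof -
  let ?A = "\<lambda>v. {w \<in> V. E v w}"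
  have "\<exists>f. (\<forall>i\<in>V. f i \<in> ?A i) \<and> (\<forall>b. card {i \<in> V. f i = b} \<le> 2)"
  proof (rule hall_marriage_capacity[OF fin])
    show "card X \<le> 2 * card (\<Union>(?A ` X))" if X: "X \<subseteq> V" for X
    proof -
      \<comment> \<open>The neighbours of the isolated vertices of the graph induced on \<open>X\<close> avoid \<open>X\<close>; every
        other vertex of \<open>X\<close> is a neighbour of \<open>X\<close> itself.\<close>
      let ?X0 = "{v \<in> X. \<forall>w\<in>X. \<not> E v w}"
      let ?NX = "\<Union>(?A ` ?X0)"
      have finX: "finite X" using X fin by (rule finite_subset)
      have finU: "finite (\<Union>(?A ` X))" using finX fin by simp
      \<comment> \<open>Deleting all neighbours of \<open>?X0\<close> leaves its members isolated,
        so \<open>iso\<close> applies to the set \<open>?NX\<close>.\<close>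
      have "card ?X0 \<le> card (isolated_outside V E ?NX)"
        using X fin by (intro card_mono) auto
      also have "\<dots> \<le> 2 * card ?NX" by (rule iso) auto
      finally have 1: "card ?X0 \<le> 2 * card ?NX" .
      have disj: "?NX \<inter> (X - ?X0) = {}" by auto
      have sub: "?NX \<union> (X - ?X0) \<subseteq> \<Union>(?A ` X)" using X sym by auto
      have "card ?NX + card (X - ?X0) = card (?NX \<union> (X - ?X0))"
        using finX finite_subset[OF sub finU] disj by (intro card_Un_disjoint[symmetric]) auto
      also have "\<dots> \<le> card (\<Union>(?A ` X))" by (rule card_mono[OF finU sub])
      finally have 2: "card ?NX + card (X - ?X0) \<le> card (\<Union>(?A ` X))" .
      have "card X = card ?X0 + card (X - ?X0)"
        using finX by (metis (no_types, lifting) card_Diff_subset card_mono finite_subset le_add_diff_inverse mem_Collect_eq subsetI)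
      then show ?thesis using 1 2 by linarith
    qed
  qed (use fin in auto)
  then obtain f where f: "\<And>v. v \<in> V \<Longrightarrow> f v \<in> ?A v" "\<And>b. card {i \<in> V. f i = b} \<le> 2" by blast
  show ?thesis
    by (rule star_partition_of_functional_graph[of V E f]) (use assms f in blast)+
qed

section \<open>Star partitions through a prescribed edge\<close>

lemma card_subset_insert_le:
  assumes "finite B" "A \<subseteq> insert x B"
  shows "card A \<le> Suc (card B)"
proof -
  have "card A \<le> card (insert x B)" using assms by (intro card_mono) auto
  also have "\<dots> \<le> Suc (card B)" using assms by (simp add: card_insert_if)
  finally show ?thesis .
qed

text \<open>The modified graph satisfies the criterion for star partitions. In it \<open>u\<close>
  and \<open>v\<close> must share a star, which is then turned back into a star of the original
  graph using \<open>uv\<close>.\<close>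

lemma star_partition_exists_containing:
  assumes fin: "finite V" and sym: "\<And>x y. E x y \<Longrightarrow> E y x" and irr: "\<And>x. \<not> E x x"
    and uv: "u \<in> V" "v \<in> V" "E u v"
    and iso: "\<And>S. S \<subseteq> V \<Longrightarrow> card (isolated_outside V E S) \<le> 2 * card S"
    and iso_uv: "\<And>S. S \<subseteq> V \<Longrightarrow> u \<in> S \<Longrightarrow> v \<in> S \<Longrightarrow> card (isolated_outside V E S) + 3 \<le> 2 * card S"
  shows "\<exists>h. star_partition V E h \<and> (h u = v \<or> h v = u)"
proof -
  \<comment> \<open>\<open>u\<close> becomes the hub, \<open>v\<close> the pendant vertex.\<close>
  define E' where "E' x y \<longleftrightarrow>
      x \<in> {u, v} \<and> y \<in> {u, v} \<and> x \<noteq> y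
    \<or> x \<notin> {u, v} \<and> y \<notin> {u, v} \<and> E x y
    \<or> x = u \<and> y \<notin> {u, v} \<and> (E u y \<or> E v y)
    \<or> y = u \<and> x \<notin> {u, v} \<and> (E u x \<or> E v x)" for x y
  have ne: "u \<noteq> v" using irr uv by auto
  have finI: "finite (isolated_outside V P S)" for P :: "'a \<Rightarrow> 'a \<Rightarrow> bool" and S using fin by simp
  have "\<exists>h. star_partition V E' h"
  proof (rule star_partition_exists[OF fin])
    show "E' y x" if "E' x y" for x y using that sym unfolding E'_def by blast
    show "\<not> E' x x" for x using irr unfolding E'_def by blast
    fix S assume S: "S \<subseteq> V"
    have finS: "finite S" using S fin by (rule finite_subset)
    consider "u \<in> S" "v \<in> S" | "u \<in> S" "v \<notin> S" | "u \<notin> S" "v \<in> S" | "u \<notin> S" "v \<notin> S" by blast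
    then show "card (isolated_outside V E' S) \<le> 2 * card S"
    proof cases
      case 1
      have "isolated_outside V E' S \<subseteq> isolated_outside V E S"
        using 1 unfolding E'_def by blast
      from card_mono[OF finI this] show ?thesis using iso_uv[OF S 1] by linarith
    next
      case 2
      \<comment> \<open>Without the hub, \<open>v\<close> is isolated and adds one. Since
        \<open>insert v S\<close> has one element more than \<open>S\<close>, the bound is
        \<open>1 + 2 * (card S + 1) - 3\<close>, which is why the constant is 3.\<close>
      have "isolated_outside V E' S \<subseteq> insert v (isolated_outside V E (insert v S))"
        using 2 unfolding E'_def by blast
      from card_subset_insert_le[OF finI this]
      have "card (isolated_outside V E' S) \<le> Suc (card (isolated_outside V E (insert v S)))"
        .
      then show ?thesis using iso_uv[of "insert v S"] S 2 uv finS by simp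
    next
      case 3
      \<comment> \<open>The hub itself may be isolated. Any other isolated vertex is adjacent to
        neither \<open>u\<close> nor \<open>v\<close>, so it stays isolated when \<open>v\<close> is
        put back.\<close>
      have "isolated_outside V E' S \<subseteq> insert u (isolated_outside V E (S - {v}))"
        using 3 uv sym unfolding E'_def by blast
      from card_subset_insert_le[OF finI this]
      have "card (isolated_outside V E' S) \<le> Suc (card (isolated_outside V E (S - {v})))"
        .
      moreover have "card S = Suc (card (S - {v}))" using 3 finS by (intro card.remove)
      ultimately show ?thesis using iso[of "S - {v}"] S by fastforce
    next
      case 4
      have "isolated_outside V E' S \<subseteq> isolated_outside V E S"
        using 4 uv ne sym unfolding E'_def by blast
      from card_mono[OF finI this] show ?thesis using iso[OF S] by linarith
    qed
  qed
  then obtain h where h: "star_partition V E' h" by blast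
  have hV: "h x \<in> V" "h (h x) = h x" "h x = x \<or> E' (h x) x" "card {w \<in> V. h w = h x} \<in> {2, 3}"
    if "x \<in> V" for x using h that unfolding star_partition_def by blast+
  have E'E: "E x y" if "E' x y" "x \<noteq> u" "y \<noteq> u" for x y
    using that unfolding E'_def by blast
  have pendant: "w = u" if "E' v w \<or> E' w v" for w
    using that ne unfolding E'_def by auto
  \<comment> \<open>As \<open>v\<close> is pendant at \<open>u\<close> and no star is a single
    vertex, both lie in one star, centred at one of them.\<close>
  have hv: "h u = v \<and> h v = v \<or> h v = u \<and> h u = u"
  proof (cases "h v = v")
    case True
    have "{w \<in> V. h w = v} \<subseteq> {u, v}" using hV(3) pendant by fastforce
    moreover have "{w \<in> V. h w = v} \<noteq> {v}"
      using hV(4)[OF uv(2)] True by auto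
    ultimately show ?thesis using True uv by blast
  next
    case False
    then have "h v = u" using hV(3)[OF uv(2)] pendant by blast
    then show ?thesis using hV(2)[OF uv(2)] by simp
  qed
  show ?thesis
  \<comment> \<open>If all leaves at \<open>u\<close> are neighbours of \<open>u\<close> in the
    original graph, \<open>h\<close> can be kept; otherwise some leaf \<open>w\<close> is adjacent
    to \<open>v\<close> only.\<close>
  proof (cases "\<exists>w \<in> V. h w = u \<and> w \<noteq> u \<and> \<not> E u w")
    case False
    have "star_partition V E h" unfolding star_partition_def
    proof (intro ballI conjI impI)
      fix x assume x: "x \<in> V" "h x \<noteq> x"
      then have "E' (h x) x" using hV by blast
      show "E (h x) x"
      proof (cases "h x = u \<or> x = u")
        case True
        then show ?thesis
        proof
          assume "h x = u"
          then show ?thesis using x False by auto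
        next
          assume "x = u"
          then show ?thesis using x(2) hv sym[OF uv(3)] by auto
        qed
      next
        case False
        then show ?thesis using E'E[OF \<open>E' (h x) x\<close>] by blast
      qed
    qed (use hV in blast)+
    then show ?thesis using hv by blast
  next
    case True
    then obtain w where w: "w \<in> V" "h w = u" "w \<noteq> u" "\<not> E u w" by blast
    then have wv: "w \<noteq> v" using uv by blast
    have hu: "h u = u" "h v = u" using hV(2)[OF w(1)] w hv ne by auto
    have "E' u w" using hV(3)[OF w(1)] w by auto
    then have Evw: "E v w" using w wv ne unfolding E'_def by auto
    \<comment> \<open>\<open>u\<close>, \<open>v\<close> and \<open>w\<close> already fill their
      star, which has at most three vertices.\<close>
    have "card {x \<in> V. h x = u} \<le> 3" using hV(4)[OF uv(1)] hu by auto
    moreover have "{u, v, w} \<subseteq> {x \<in> V. h x = u}" "card {u, v, w} = 3"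
      using uv w wv hu ne by auto
    ultimately have cls: "{x \<in> V. h x = u} = {u, v, w}"
      using fin card_seteq[of "{x \<in> V. h x = u}" "{u, v, w}"] by auto
    \<comment> \<open>The hub edge \<open>uw\<close> comes from \<open>vw\<close>, so \<open>v\<close> has to be the centre in the original graph.\<close>
    let ?h = "\<lambda>x. if h x = u then v else h x"
    have hxv: "h x \<noteq> v" if "x \<in> V" for x using hV(2)[OF that] hu ne by auto
    have same: "{y \<in> V. ?h y = ?h x} = {y \<in> V. h y = h x}" if "x \<in> V" for x
      using hxv that by auto
    have "star_partition V E ?h" unfolding star_partition_def
    proof (intro ballI conjI impI)
      fix x assume x: "x \<in> V"
      show "?h x \<in> V" using hV x uv by simp
      show "?h (?h x) = ?h x" using hV x hu by simp
      show "card {w \<in> V. ?h w = ?h x} \<in> {2, 3}" using same[OF x] hV(4)[OF x] by simp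
      assume ne: "?h x \<noteq> x"
      show "E (?h x) x"
      proof (cases "h x = u")
        case True
        then have "x = u \<or> x = w" using x cls ne by auto
        then show ?thesis using True Evw uv sym by auto
      next
        case False
        then have "E' (h x) x" using hV(3)[OF x] ne by auto
        then show ?thesis using E'E False hu by auto
      qed
    qed
    then show ?thesis using hu by (intro exI[of _ ?h]) simp
  qed
qed

section \<open>Counting factor edges at isolated vertices\<close>

text \<open>\<open>N x\<close> stands for the neighbours of \<open>x\<close> in a factor. Each
  vertex of \<open>I\<close> sends at least one edge into \<open>S\<close>, and each vertex of
  \<open>S\<close> receives at most two. An edge \<open>uv\<close> inside \<open>S\<close> costs two
  of these places. The last hypothesis, true in factors because two adjacent vertices of degree 2
  lie on a circuit, gains one more.\<close>

lemma isolated_card_bounds: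
  fixes N :: "'a \<Rightarrow> 'a set"
  assumes fin: "finite I" "finite S" and disj: "I \<inter> S = {}"
    and sym: "\<And>x y. y \<in> N x \<Longrightarrow> x \<in> N y"
    and IS: "\<And>x. x \<in> I \<Longrightarrow> N x \<subseteq> S"
    and deg: "\<And>x. x \<in> I \<union> S \<Longrightarrow> 1 \<le> card (N x) \<and> card (N x) \<le> 2"
  shows "card I \<le> 2 * card S"
    and "\<lbrakk>u \<in> S; v \<in> S; u \<noteq> v; v \<in> N u;
          \<And>x y z. \<lbrakk>y \<in> N x; z \<in> N y; card (N x) = 2; card (N y) = 2\<rbrakk> \<Longrightarrow> card (N z) = 2\<rbrakk>
      \<Longrightarrow> card I + 3 \<le> 2 * card S"
proof -
  let ?b = "\<lambda>s. card (N s \<inter> I)"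
  have finN: "finite (N x)" if "x \<in> I \<union> S" for x
    using deg[OF that] card.infinite by fastforce
  \<comment> \<open>Double counting of the edges between \<open>I\<close> and
    \<open>S\<close>.\<close>
  have "(\<Sum>x\<in>I. card (N x)) = (\<Sum>x\<in>I. card {s \<in> S. s \<in> N x})"
    using IS by (intro sum.cong refl arg_cong[where f = card]) auto
  also have "\<dots> = (\<Sum>s\<in>S. card {x \<in> I. s \<in> N x})"
    using sum.swap_restrict[OF fin, of "\<lambda>_ _. 1::nat" "\<lambda>x s. s \<in> N x"] by simp
  also have "\<dots> = (\<Sum>s\<in>S. ?b s)"
    using sym by (intro sum.cong refl arg_cong[where f = card]) auto
  finally have count: "(\<Sum>x\<in>I. card (N x)) = (\<Sum>s\<in>S. ?b s)" .
  have b: "?b s \<le> card (N s)" "?b s \<le> 2" if "s \<in> S" for s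
  proof -
    show "?b s \<le> card (N s)" using that finN by (intro card_mono) auto
    then show "?b s \<le> 2" using deg[of s] that by simp
  qed
  have low: "card I \<le> (\<Sum>x\<in>I. card (N x))"
    using sum_mono[of I "\<lambda>_. 1" "\<lambda>x. card (N x)"] deg by simp
  show "card I \<le> 2 * card S"
    using low count sum_bounded_above[of S ?b 2] b by simp
  assume uv: "u \<in> S" "v \<in> S" "u \<noteq> v" "v \<in> N u"
    and path: "\<And>x y z. \<lbrakk>y \<in> N x; z \<in> N y; card (N x) = 2; card (N y) = 2\<rbrakk> \<Longrightarrow> card (N z) = 2"
  \<comment> \<open>The edge \<open>uv\<close> stays inside \<open>S\<close>, so each of its ends
    has a neighbour outside \<open>I\<close>.\<close>
  have less: "?b x < card (N x)" if "x \<in> {u, v}" for x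
  proof (rule psubset_card_mono)
    show "finite (N x)" using that uv finN by auto
    show "N x \<inter> I \<subset> N x" using that uv sym disj by auto
  qed
  have "(\<Sum>s\<in>S. ?b s) = (\<Sum>s\<in>S - {u, v}. ?b s) + (?b u + ?b v)"
    using sum.subset_diff[of "{u, v}" S ?b] uv fin by simp
  moreover have "(\<Sum>s\<in>S - {u, v}. ?b s) \<le> 2 * (card S - 2)"
    using sum_bounded_above[of "S - {u, v}" ?b 2] b uv fin by (simp add: card_Diff_subset)
  moreover have "2 \<le> card S" using card_mono[OF fin(2), of "{u, v}"] uv by simp
  ultimately have total: "(\<Sum>x\<in>I. card (N x)) + 4 \<le> 2 * card S + ?b u + ?b v"
    using count by simp
  have small: "?b u \<le> 1" "?b v \<le> 1" using less deg[of u] deg[of v] uv by fastforce+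
  show "card I + 3 \<le> 2 * card S"
  proof (rule ccontr)
    assume "\<not> ?thesis"
    \<comment> \<open>Failure forces equality: \<open>u\<close> and \<open>v\<close> have degree 2
      with one neighbour each in \<open>I\<close>, so the neighbour \<open>w\<close> of
      \<open>u\<close> in \<open>I\<close> has degree 2 as well, whereas \<open>eq\<close> leaves
      only degree 1 for the vertices of \<open>I\<close>.\<close>
    then have bb: "?b u = 1" "?b v = 1" and eq: "(\<Sum>x\<in>I. card (N x)) \<le> card I"
      using total low small by linarith+
    obtain w where w: "w \<in> N u" "w \<in> I" using bb(1) by (metis Int_iff card.empty equals0I zero_neq_one)
    have "card (N u) = 2" "card (N v) = 2" using bb less[of u] less[of v] deg[of u] deg[of v] uv by auto
    then have "card (N w) = 2" using path[of u v w] sym uv w by blast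
    moreover have "(\<Sum>x\<in>I. card (N x)) = card (N w) + (\<Sum>x\<in>I - {w}. card (N x))"
      using w fin by (simp add: sum.remove)
    moreover have "card (I - {w}) \<le> (\<Sum>x\<in>I - {w}. card (N x))"
      using sum_mono[of "I - {w}" "\<lambda>_. 1" "\<lambda>x. card (N x)"] deg by simp
    moreover have "card I = Suc (card (I - {w}))" using w fin by (intro card.remove)
    ultimately show False using eq by linarith
  qed
qed

section \<open>Star-circuit factors\<close>

lemma (in wf_digraph) subgraph_induceI:
  assumes "subgraph H G" "verts H \<subseteq> V"
  shows "subgraph H (G \<restriction> V)"
proof -
  have "wf_digraph H" using assms(1) by auto
  then have "tail G a \<in> V \<and> head G a \<in> V" if "a \<in> arcs H" for a
    using that assms wf_digraph.wellformed[of H a]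
    by (auto simp: subgraph_def compatible_def)
  then show ?thesis
    using assms wellformed_induce_subgraph[of V] by (auto simp: subgraph_def compatible_def)
qed

lemma (in graph) graph_induce:
  assumes "V \<subseteq> verts G"
  shows "graph (G \<restriction> V)"
proof -
  have ind: "induced_subgraph (G \<restriction> V) G" using assms by (rule induced_induce)
  interpret I: digraph "G \<restriction> V" using ind by (rule digraphI_induced)
  interpret I: sym_digraph "G \<restriction> V" using ind by (rule induced_graph_imp_graph)
  show ?thesis by unfold_locales
qed

lemma connected_if_strongly_connected:
  assumes "strongly_connected H"
  shows "Digraph_Component.connected H"
  using assms unfolding connected_conv strongly_connected_def reachable_def symcl_def
  by (auto intro: rtrancl_on_mono)

context sym_digraph
begin

lemma reachable_if_connected_subgraph:
  assumes C: "Digraph_Component.connected C" "subgraph C G" and uv: "u \<in> verts C" "v \<in> verts C"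
  shows "u \<rightarrow>\<^sup>*\<^bsub>G\<^esub> v"
proof -
  have "(u, v) \<in> rtrancl_on (verts C) ((arcs_ends C)\<^sup>s)"
    using C(1) uv unfolding connected_conv by blast
  moreover have "(arcs_ends C)\<^sup>s \<subseteq> arcs_ends G"
    using C(2) graph_symmetric unfolding symcl_def subgraph_def compatible_def arcs_ends_conv
    by fastforce
  moreover have "verts C \<subseteq> verts G" using C(2) by auto
  ultimately show ?thesis unfolding reachable_def by (meson rtrancl_on_mono subsetD)
qed

text \<open>By symmetry, components are the strongly connected components, that is, the reachability
  classes; this explicit form replaces maximality from here on.\<close>

lemma component_conv_reachable:
  "component C G \<longleftrightarrow> (\<exists>u \<in> verts G. C = G \<restriction> {v. u \<rightarrow>\<^sup>*\<^bsub>G\<^esub> v})"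
proof
  assume "component C G"
  then have C: "subgraph C G" "Digraph_Component.connected C"
    and max: "\<And>D. subgraph C D \<Longrightarrow> subgraph D G \<Longrightarrow> Digraph_Component.connected D \<Longrightarrow> D = C"
    unfolding component_def max_subgraph_def by auto
  obtain u where u: "u \<in> verts C" using C(2) unfolding connected_conv by blast
  let ?D = "G \<restriction> {v. u \<rightarrow>\<^sup>*\<^bsub>G\<^esub> v}"
  have uG: "u \<in> verts G" using u C(1) by auto
  have D: "?D \<in> sccs" using uG by (rule induce_reachable_is_in_sccs)
  have "?D = C"
  proof (rule max)
    show "subgraph ?D G" using D by (blast intro: induced_imp_subgraph)
    show "Digraph_Component.connected ?D"
      using D connected_if_strongly_connected unfolding sccs_def by blast
    have "verts C \<subseteq> {v. u \<rightarrow>\<^sup>*\<^bsub>G\<^esub> v}"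
      using reachable_if_connected_subgraph[OF C(2,1) u] by blast
    then show "subgraph C ?D"
      using C(1) by (intro subgraph_induceI)
  qed
  then show "\<exists>u \<in> verts G. C = G \<restriction> {v. u \<rightarrow>\<^sup>*\<^bsub>G\<^esub> v}" using uG by blast
next
  assume "\<exists>u \<in> verts G. C = G \<restriction> {v. u \<rightarrow>\<^sup>*\<^bsub>G\<^esub> v}"
  then obtain u where u: "u \<in> verts G" and C: "C = G \<restriction> {v. u \<rightarrow>\<^sup>*\<^bsub>G\<^esub> v}" by blast
  then have scc: "C \<in> sccs" by (simp add: induce_reachable_is_in_sccs)
  show "component C G" unfolding component_def
  proof (rule max_subgraphI)
    show "Digraph_Component.connected C"
      using scc connected_if_strongly_connected unfolding sccs_def by blast
    show "subgraph C G" using scc by (blast intro: induced_imp_subgraph)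
    fix D assume D: "C \<noteq> D" "subgraph C D" "subgraph D G"
    show "\<not> Digraph_Component.connected D"
    proof
      assume con: "Digraph_Component.connected D"
      have "u \<in> verts C" using u C by simp
      then have "u \<in> verts D" using D(2) unfolding subgraph_def by blast
      then have "verts D \<subseteq> verts C"
        using reachable_if_connected_subgraph[OF con D(3)] C by auto
      then have "subgraph D C"
        using D(3) unfolding C by (intro subgraph_induceI) auto
      then show False using D(1,2) unfolding subgraph_def compatible_def
        by (auto intro!: pre_digraph.equality)
    qed
  qed
qed

end

section \<open>Factors, star partitions and degrees\<close>

lemma (in nomulti_digraph) card_dominated:
  "card {w. v \<rightarrow>\<^bsub>G\<^esub> w} = out_degree G v"
proof -
  have "{w. v \<rightarrow>\<^bsub>G\<^esub> w} = head G ` out_arcs G v"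
    by (auto simp: out_arcs_def arcs_ends_conv)
  moreover have "inj_on (head G) (out_arcs G v)"
    by (intro inj_onI no_multi_arcs) (auto simp: arc_to_ends_def)
  ultimately show ?thesis by (simp add: out_degree_def card_image)
qed

text \<open>The factor consists of the edges between a vertex and its centre, so its components are
  the fibres of \<open>h\<close>. The description of its edges is what later places
  \<open>uv\<close> in the factor.\<close>

lemma star_circuit_factor_of_star_partition:
  assumes "graph G" and h: "star_partition (verts G) (\<lambda>x y. x \<rightarrow>\<^bsub>G\<^esub> y) h"
  shows "\<exists>F. star_circuit_factor F G \<and> (\<forall>u v. u \<rightarrow>\<^bsub>F\<^esub> v \<longleftrightarrow> u \<rightarrow>\<^bsub>G\<^esub> v \<and> (h u = v \<or> h v = u))"
proof -
  interpret graph G by fact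
  \<comment> \<open>Testing both ends of an arc makes \<open>F\<close> symmetric; choosing among the
    arcs of \<open>G\<close> excludes loops at the centres.\<close>
  define F where "F = G\<lparr>arcs := {a \<in> arcs G. h (tail G a) = head G a \<or> h (head G a) = tail G a}\<rparr>"
  have Fs[simp]: "verts F = verts G" "tail F = tail G" "head F = head G"
      "arcs F = {a \<in> arcs G. h (tail G a) = head G a \<or> h (head G a) = tail G a}"
    by (simp_all add: F_def)
  have dom: "u \<rightarrow>\<^bsub>F\<^esub> v \<longleftrightarrow> u \<rightarrow>\<^bsub>G\<^esub> v \<and> (h u = v \<or> h v = u)" for u v
    by (auto simp: arcs_ends_conv)
  have "graph F"
  proof
    show "finite (verts F)" "finite (arcs F)" by simp_all
    show "tail F e \<in> verts F" "head F e \<in> verts F" "tail F e \<noteq> head F e" if "e \<in> arcs F" for e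
      using that no_loops by auto
    show "e1 = e2" if "e1 \<in> arcs F" "e2 \<in> arcs F" "arc_to_ends F e1 = arc_to_ends F e2" for e1 e2
      using that no_multi_arcs by (auto simp: arc_to_ends_def)
    show "symmetric F" unfolding symmetric_def
      by (intro symI) (use dom graph_symmetric in blast)
  qed
  interpret F: graph F by fact
  have hG: "h x \<in> verts G" "h (h x) = h x" "h x \<noteq> x \<Longrightarrow> h x \<rightarrow>\<^bsub>G\<^esub> x"
    "card {w \<in> verts G. h w = h x} \<in> {2, 3}" if "x \<in> verts G" for x
    using h that unfolding star_partition_def by blast+
  have hF: "h x \<rightarrow>\<^bsub>F\<^esub> x" if "x \<in> verts G" "h x \<noteq> x" for x
    using hG that dom by blast
  have irr: "\<not> x \<rightarrow>\<^bsub>F\<^esub> x" for x using F.no_loops by (auto simp: arcs_ends_conv)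
  have star: "K\<^bsub>1,1\<^esub> (F \<restriction> {v. u \<rightarrow>\<^sup>*\<^bsub>F\<^esub> v}) \<or> K\<^bsub>1,2\<^esub> (F \<restriction> {v. u \<rightarrow>\<^sup>*\<^bsub>F\<^esub> v})"
    if u: "u \<in> verts F" for u
  proof -
    let ?C = "{v \<in> verts G. h v = h u}"
    have uG: "u \<in> verts G" using u by simp
    \<comment> \<open>Edges of \<open>F\<close> stay within a fibre, and every vertex is joined to
      its centre.\<close>
    have cls: "{v. u \<rightarrow>\<^sup>*\<^bsub>F\<^esub> v} = ?C"
    proof (intro subset_antisym subsetI CollectI)
      fix v assume "v \<in> {v. u \<rightarrow>\<^sup>*\<^bsub>F\<^esub> v}"
      then have "u \<rightarrow>\<^sup>*\<^bsub>F\<^esub> v" by simp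
      then show "v \<in> verts G \<and> h v = h u"
      proof (induction rule: F.reachable_induct)
        case base
        then show ?case using uG by simp
      next
        case (step x y)
        then show ?case using dom[of x y] hG(1)[of x] hG(2)[of x] hG(2)[of y] by auto
      qed
    next
      have up: "x \<rightarrow>\<^sup>*\<^bsub>F\<^esub> h x" "h x \<rightarrow>\<^sup>*\<^bsub>F\<^esub> x" if "x \<in> verts G" for x
      proof -
        show "h x \<rightarrow>\<^sup>*\<^bsub>F\<^esub> x" using hF[OF that] that by (cases "h x = x") auto
        then show "x \<rightarrow>\<^sup>*\<^bsub>F\<^esub> h x" by (rule symmetric_reachable[OF F.sym_arcs])
      qed
      fix v assume "v \<in> ?C"
      then show "u \<rightarrow>\<^sup>*\<^bsub>F\<^esub> v" using up[of v] up[OF uG] by (auto intro: F.reachable_trans)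
    qed
    let ?K = "F \<restriction> ?C"
    have "graph ?K" by (rule F.graph_induce) auto
    let ?V = "?C - {h u}"
    have hu: "h u \<in> ?C" using hG uG by simp
    have "arcs_ends ?K = {(x, y). x \<in> ?C \<and> y \<in> ?C \<and> x \<rightarrow>\<^bsub>F\<^esub> y}"
      by (auto simp: arcs_ends_conv)
    also have "\<dots> = {h u} \<times> ?V \<union> ?V \<times> {h u}"
    proof -
      have "x \<rightarrow>\<^bsub>F\<^esub> y \<longleftrightarrow> (x = h u) \<noteq> (y = h u)" if "x \<in> ?C" "y \<in> ?C" for x y
        using that dom[of x y] irr[of "h u"] hF[of x] hF[of y] F.graph_symmetric by auto
      then show ?thesis using hu by blast
    qed
    finally have ends: "arcs_ends ?K = {h u} \<times> ?V \<union> ?V \<times> {h u}" .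
    have "K\<^bsub>1,card ?V\<^esub> ?K" unfolding complete_bipartite_digraph_def
      by (intro conjI exI[of _ "{h u}"] exI[of _ ?V] \<open>graph ?K\<close> ends) (use hu in auto)
    moreover have "card ?V \<in> {1, 2}" using hG(4)[OF uG] hu by auto
    ultimately show ?thesis unfolding cls by auto
  qed
  have "spanning F G" unfolding spanning_def subgraph_def compatible_def
    using wf_digraph_axioms F.wf_digraph_axioms by auto
  moreover have "K\<^bsub>1,1\<^esub> C \<or> K\<^bsub>1,2\<^esub> C" if C: "component C F" for C
  proof -
    obtain u where "u \<in> verts F" "C = F \<restriction> {v. u \<rightarrow>\<^sup>*\<^bsub>F\<^esub> v}"
      using C unfolding F.component_conv_reachable by (elim bexE)
    then show ?thesis using star[of u] by metis
  qed
  ultimately have "star_circuit_factor F G" unfolding star_circuit_factor_def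
    using \<open>graph F\<close> by metis
  then show ?thesis using dom by blast
qed

text \<open>These are the facts about degrees that the double count uses. In a star only the centre
  can have degree 2, so two adjacent vertices of degree 2 force a circuit.\<close>

lemma star_circuit_factor_neighbourhoods:
  assumes "star_circuit_factor F G"
  shows "\<And>x. x \<in> verts G \<Longrightarrow> 1 \<le> card {y. x \<rightarrow>\<^bsub>F\<^esub> y} \<and> card {y. x \<rightarrow>\<^bsub>F\<^esub> y} \<le> 2"
    and "\<And>x y z. \<lbrakk>x \<rightarrow>\<^bsub>F\<^esub> y; y \<rightarrow>\<^bsub>F\<^esub> z; card {w. x \<rightarrow>\<^bsub>F\<^esub> w} = 2; card {w. y \<rightarrow>\<^bsub>F\<^esub> w} = 2\<rbrakk>
      \<Longrightarrow> card {w. z \<rightarrow>\<^bsub>F\<^esub> w} = 2"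
proof -
  interpret F: graph F using assms by (simp add: star_circuit_factor_def)
  have vF: "verts F = verts G" using assms by (auto simp: star_circuit_factor_def spanning_def)
  have types: "(\<exists>c V. V \<noteq> {} \<and> card V \<le> 2 \<and> c \<notin> V \<and> {y. u \<rightarrow>\<^sup>*\<^bsub>F\<^esub> y} = insert c V
      \<and> {y. c \<rightarrow>\<^bsub>F\<^esub> y} = V \<and> (\<forall>x\<in>V. {y. x \<rightarrow>\<^bsub>F\<^esub> y} = {c}))
    \<or> (\<forall>x. u \<rightarrow>\<^sup>*\<^bsub>F\<^esub> x \<longrightarrow> card {y. x \<rightarrow>\<^bsub>F\<^esub> y} = 2)" if u: "u \<in> verts F" for u
  proof -
    let ?R = "{y. u \<rightarrow>\<^sup>*\<^bsub>F\<^esub> y}"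
    let ?C = "F \<restriction> ?R"
    \<comment> \<open>A reachability class contains all neighbours of its members, so degrees may be
      read off in the induced subgraph.\<close>
    have dom: "x \<rightarrow>\<^bsub>?C\<^esub> y \<longleftrightarrow> x \<rightarrow>\<^bsub>F\<^esub> y" if "x \<in> ?R" for x y
      using that F.reachable_adj_trans[of u x y] by (auto simp: arcs_ends_conv)
    have "component ?C F" using u F.component_conv_reachable by blast
    then consider (star) i where "i \<in> {1, 2}" "K\<^bsub>1,i\<^esub> ?C" | (circuit) m where "circuit m ?C"
      using assms unfolding star_circuit_factor_def by blast
    then show ?thesis
    proof cases
      case star
      then obtain U V where UV: "?R = U \<union> V" "U \<inter> V = {}" "card U = 1" "card V = i"
          "arcs_ends ?C = U \<times> V \<union> V \<times> U"
        unfolding complete_bipartite_digraph_def by auto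
      then obtain c where c: "U = {c}" using card_1_singletonE by blast
      have "x \<rightarrow>\<^bsub>F\<^esub> y \<longleftrightarrow> x = c \<and> y \<in> V \<or> x \<in> V \<and> y = c" if "x \<in> ?R" for x y
        using dom[OF that] UV(5) c by auto
      then have "{y. c \<rightarrow>\<^bsub>F\<^esub> y} = V \<and> (\<forall>x\<in>V. {y. x \<rightarrow>\<^bsub>F\<^esub> y} = {c})"
        using UV(1,2) c by auto
      moreover have "V \<noteq> {}" "card V \<le> 2" using UV star by auto
      ultimately show ?thesis using UV(1,2) c by (intro disjI1 exI[of _ c] exI[of _ V]) auto
    next
      case circuit
      then interpret C: graph ?C by (simp add: circuit_def)
      have "card {y. x \<rightarrow>\<^bsub>F\<^esub> y} = 2" if "x \<in> ?R" for x
        using circuit that dom[OF that] C.card_dominated[of x] by (simp add: circuit_def)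
      then show ?thesis by blast
    qed
  qed
  show "1 \<le> card {y. x \<rightarrow>\<^bsub>F\<^esub> y} \<and> card {y. x \<rightarrow>\<^bsub>F\<^esub> y} \<le> 2" if x: "x \<in> verts G" for x
  proof -
    have xx: "x \<rightarrow>\<^sup>*\<^bsub>F\<^esub> x" using x vF by simp
    have fin: "finite {y. u \<rightarrow>\<^sup>*\<^bsub>F\<^esub> y}" for u
      by (rule finite_subset[OF _ F.finite_verts]) (auto elim: reachable_in_vertsE)
    from types[OF x[folded vF]] show ?thesis
    proof (elim disjE exE conjE)
      fix c V assume *: "V \<noteq> {}" "card V \<le> 2" "{y. x \<rightarrow>\<^sup>*\<^bsub>F\<^esub> y} = insert c V"
        "{y. c \<rightarrow>\<^bsub>F\<^esub> y} = V" "\<forall>x\<in>V. {y. x \<rightarrow>\<^bsub>F\<^esub> y} = {c}"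
      have "finite V" using fin[of x] * by simp
      then have "1 \<le> card V" using *(1) by (simp add: Suc_le_eq card_gt_0_iff)
      moreover have "x = c \<or> x \<in> V" using xx *(3) by blast
      ultimately show ?thesis using * by auto
    qed (use xx in auto)
  qed
  show "card {w. z \<rightarrow>\<^bsub>F\<^esub> w} = 2"
    if xy: "x \<rightarrow>\<^bsub>F\<^esub> y" and yz: "y \<rightarrow>\<^bsub>F\<^esub> z" and two: "card {w. x \<rightarrow>\<^bsub>F\<^esub> w} = 2" "card {w. y \<rightarrow>\<^bsub>F\<^esub> w} = 2"
    for x y z
  proof -
    have xV: "x \<in> verts F" using xy by auto
    have r: "x \<rightarrow>\<^sup>*\<^bsub>F\<^esub> x" "x \<rightarrow>\<^sup>*\<^bsub>F\<^esub> z" using xV xy yz by (auto intro: F.adj_reachable_trans)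
    from types[OF xV] show ?thesis
    proof (elim disjE exE conjE)
      fix c V assume *: "c \<notin> V" "{y. x \<rightarrow>\<^sup>*\<^bsub>F\<^esub> y} = insert c V"
        "{y. c \<rightarrow>\<^bsub>F\<^esub> y} = V" "\<forall>x\<in>V. {y. x \<rightarrow>\<^bsub>F\<^esub> y} = {c}"
      \<comment> \<open>In a star both \<open>x\<close> and \<open>y\<close> would be the centre,
        which is not its own neighbour.\<close>
      have "x = c" "y = c" using two * r(1) xy by auto
      then show ?thesis using xy * by blast
    qed (use r in auto)
  qed
qed

section \<open>Isolated vertices and the equivalence\<close>

lemma num_isolated_remove_verts:
  assumes "graph G"
  shows "num_isolated (remove_verts G S) = card (isolated_outside (verts G) (\<lambda>x y. x \<rightarrow>\<^bsub>G\<^esub> y) S)"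
proof -
  interpret graph G by fact
  have "graph (remove_verts G S)" unfolding remove_verts_def
    by (rule graph_induce) auto
  note isolated = graph_isolated_iff[OF this]
  have "v \<rightarrow>\<^bsub>remove_verts G S\<^esub> w \<longleftrightarrow> v \<in> verts G - S \<and> w \<in> verts G - S \<and> v \<rightarrow>\<^bsub>G\<^esub> w" for v w
    unfolding remove_verts_def by (auto simp: arcs_ends_conv)
  moreover have "verts (remove_verts G S) = verts G - S" by (simp add: remove_verts_def)
  ultimately have "v \<in> verts (remove_verts G S) \<and> (\<forall>w. \<not> v \<rightarrow>\<^bsub>remove_verts G S\<^esub> w) \<longleftrightarrow>
      v \<in> isolated_outside (verts G) (\<lambda>x y. x \<rightarrow>\<^bsub>G\<^esub> y) S" for v
    using adj_in_verts(2) by blast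
  then show ?thesis unfolding num_isolated_def isolated by simp
qed

text \<open>Edges of \<open>F\<close> are edges of \<open>G\<close>, so a vertex isolated outside
  \<open>S\<close> has all its \<open>F\<close>-neighbours in \<open>S\<close> and the double count
  applies.\<close>

lemma star_circuit_factor_isolated:
  assumes G: "graph G" and F: "star_circuit_factor F G" and S: "S \<subseteq> verts G"
  shows "num_isolated (remove_verts G S) \<le> 2 * card S"
    and "\<lbrakk>u \<in> S; v \<in> S; u \<rightarrow>\<^bsub>F\<^esub> v\<rbrakk> \<Longrightarrow> num_isolated (remove_verts G S) + 3 \<le> 2 * card S"
proof -
  interpret graph G by fact
  interpret F: graph F using F by (simp add: star_circuit_factor_def)
  let ?I = "isolated_outside (verts G) (\<lambda>x y. x \<rightarrow>\<^bsub>G\<^esub> y) S"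
  let ?N = "\<lambda>x. {y. x \<rightarrow>\<^bsub>F\<^esub> y}"
  have vF: "verts F = verts G" and FG: "x \<rightarrow>\<^bsub>F\<^esub> y \<Longrightarrow> x \<rightarrow>\<^bsub>G\<^esub> y" for x y
    using F by (auto simp: star_circuit_factor_def spanning_def dest: adj_mono)
  have fin: "finite ?I" "finite S" using finite_subset[OF S finite_verts] by auto
  have disj: "?I \<inter> S = {}" by blast
  have sym: "x \<in> ?N y" if "y \<in> ?N x" for x y using that F.graph_symmetric by blast
  have IS: "?N x \<subseteq> S" if x: "x \<in> ?I" for x
  proof
    fix y assume "y \<in> ?N x"
    then have "x \<rightarrow>\<^bsub>G\<^esub> y" using FG by simp
    then show "y \<in> S" using x adj_in_verts(2)[of x y] by blast
  qed
  have deg: "1 \<le> card (?N x) \<and> card (?N x) \<le> 2" if "x \<in> ?I \<union> S" for x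
    using star_circuit_factor_neighbourhoods(1)[OF F] that S by blast
  note bounds = isolated_card_bounds[where N = ?N, OF fin disj sym IS deg]
  show "num_isolated (remove_verts G S) \<le> 2 * card S"
    using bounds(1) num_isolated_remove_verts[OF G] by simp
  assume uv: "u \<in> S" "v \<in> S" "u \<rightarrow>\<^bsub>F\<^esub> v"
  have "u \<noteq> v" using uv(3) F.no_loops by (auto simp: arcs_ends_conv)
  then have "card ?I + 3 \<le> 2 * card S"
    using uv star_circuit_factor_neighbourhoods(2)[OF F] by (intro bounds(2)[of u v]) auto
  then show "num_isolated (remove_verts G S) + 3 \<le> 2 * card S"
    using num_isolated_remove_verts[OF G] by simp
qed

text \<open>Since \<open>G\<close> has a factor, the upper bound holds for every \<open>S\<close>.
  What decides is therefore the lower bound, whose failure for all \<open>S\<close> containing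
  \<open>u\<close> and \<open>v\<close> is equivalent to a factor through \<open>uv\<close>.
  Integers avoid truncated subtraction.\<close>

lemma no_star_circuit_factor_containing_iff:
  assumes G: "graph G" and F: "\<exists>F. star_circuit_factor F G" and uv: "u \<rightarrow>\<^bsub>G\<^esub> v"
  shows "(\<nexists>F. star_circuit_factor F G \<and> u \<rightarrow>\<^bsub>F\<^esub> v) \<longleftrightarrow>
    (\<exists>S \<subseteq> verts G. u \<in> S \<and> v \<in> S \<and>
      2 * int (card S) - 2 \<le> int (num_isolated (remove_verts G S)) \<and>
      int (num_isolated (remove_verts G S)) \<le> 2 * int (card S))" (is "?L \<longleftrightarrow> ?R")
proof
  interpret graph G by fact
  let ?E = "\<lambda>x y. x \<rightarrow>\<^bsub>G\<^esub> y"
  have upper: "num_isolated (remove_verts G S) \<le> 2 * card S" if "S \<subseteq> verts G" for S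
    using star_circuit_factor_isolated(1)[OF G _ that] F by blast
  show ?R if ?L
  proof (rule ccontr)
    assume noR: "\<not> ?R"
    have "\<exists>h. star_partition (verts G) ?E h \<and> (h u = v \<or> h v = u)"
    proof (rule star_partition_exists_containing)
      show "card (isolated_outside (verts G) ?E S) \<le> 2 * card S" if "S \<subseteq> verts G" for S
        using upper[OF that] num_isolated_remove_verts[OF G] by simp
      show "card (isolated_outside (verts G) ?E S) + 3 \<le> 2 * card S"
        if S: "S \<subseteq> verts G" "u \<in> S" "v \<in> S" for S
      proof -
        \<comment> \<open>Over the integers this negation says that the number of isolated vertices
          plus 3 is at most \<open>2 * card S\<close>.\<close>
        have "\<not> 2 * int (card S) - 2 \<le> int (num_isolated (remove_verts G S))"
          using noR S upper[OF S(1)] by fastforce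
        then show ?thesis using num_isolated_remove_verts[OF G] by simp
      qed
      show "\<not> ?E x x" for x using no_loops by (auto simp: arcs_ends_conv)
    qed (use uv graph_symmetric in auto)
    then show False
      using star_circuit_factor_of_star_partition[OF G] uv \<open>?L\<close> by blast
  qed
  show ?L if ?R
  proof
    assume "\<exists>F. star_circuit_factor F G \<and> u \<rightarrow>\<^bsub>F\<^esub> v"
    then obtain F where F: "star_circuit_factor F G" "u \<rightarrow>\<^bsub>F\<^esub> v" by blast
    obtain S where S: "S \<subseteq> verts G" "u \<in> S" "v \<in> S"
      "2 * int (card S) - 2 \<le> int (num_isolated (remove_verts G S))"
      using \<open>?R\<close> by blast
    have "num_isolated (remove_verts G S) + 3 \<le> 2 * card S"
      by (rule star_circuit_factor_isolated(2)[OF G F(1) S(1-3) F(2)])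
    then show False using S(4) by linarith
  qed
qed


lemma star_circuit_factor_if_star_partition:
  assumes "graph G" "star_partition (verts G) (\<lambda>x y. x \<rightarrow>\<^bsub>G\<^esub> y) h"
  shows "\<exists>F. star_circuit_factor F G"
  using star_circuit_factor_of_star_partition[OF assms] by blast

section \<open>Extremal examples\<close>

text \<open>
  The edge \<open>01\<close> with \<open>k\<close> leaves attached to each end.
\<close>

definition double_star :: "nat \<Rightarrow> (nat, nat \<times> nat) pre_digraph" where
  "double_star k = (let E = {(0, 1)} \<union> {0} \<times> {2..<k + 2} \<union> {1} \<times> {k + 2..<2 * k + 2} in
     \<lparr>verts = {..<2 * k + 2}, arcs = E \<union> E\<inverse>, tail = fst, head = snd\<rparr>)"

lemma graph_double_star: "graph (double_star k)"
proof
  let ?G = "double_star k"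
  have fin: "arcs ?G \<subseteq> verts ?G \<times> verts ?G" by (auto simp: double_star_def Let_def)
  then show "finite (arcs ?G)"
    by (rule finite_subset) (simp add: double_star_def Let_def)
  show "finite (verts ?G)" by (simp add: double_star_def Let_def)
  show "tail ?G e \<in> verts ?G" "head ?G e \<in> verts ?G" if "e \<in> arcs ?G" for e
    using fin that by (auto simp: double_star_def Let_def)
  show "tail ?G e \<noteq> head ?G e" if "e \<in> arcs ?G" for e
    using that by (auto simp: double_star_def Let_def)
  show "e1 = e2" if "arc_to_ends ?G e1 = arc_to_ends ?G e2" for e1 e2
    using that by (auto simp: double_star_def Let_def arc_to_ends_def prod_eq_iff)
  show "symmetric ?G" unfolding symmetric_def
    by (auto simp: double_star_def Let_def arcs_ends_conv intro!: symI)
qed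

lemma double_star_dominates:
  "x \<rightarrow>\<^bsub>double_star k\<^esub> y \<longleftrightarrow>
    (let E = {(0, 1)} \<union> {0} \<times> {2..<k + 2} \<union> {1} \<times> {k + 2..<2 * k + 2} in (x, y) \<in> E \<or> (y, x) \<in> E)"
proof -
  have "arcs_ends (double_star k) = arcs (double_star k)"
    by (simp add: arcs_ends_conv double_star_def Let_def)
  then show ?thesis
    by (simp only: double_star_def Let_def pre_digraph.select_convs Un_iff converse_iff)
qed

lemma double_star_factor:
  assumes "k \<in> {1, 2}"
  shows "\<exists>F. star_circuit_factor F (double_star k)"
proof (rule star_circuit_factor_if_star_partition[OF graph_double_star])
  \<comment> \<open>Two stars with centres 0 and 1 and \<open>k\<close> leaves each, so every fibre
    has \<open>k + 1\<close> vertices.\<close>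
  let ?h = "\<lambda>x. if x = 0 \<or> 2 \<le> x \<and> x < k + 2 then 0 else 1 :: nat"
  let ?V = "verts (double_star k)"
  have V: "?V = {..<2 * k + 2}" by (simp add: double_star_def Let_def)
  have "{w \<in> ?V. ?h w = 0} = insert 0 {2..<k + 2}" "{w \<in> ?V. ?h w = 1} = insert 1 {k + 2..<2 * k + 2}"
    unfolding V by auto
  then have "card {w \<in> ?V. ?h w = 0} = k + 1" "card {w \<in> ?V. ?h w = 1} = k + 1"
    by simp_all
  then have "card {w \<in> ?V. ?h w = ?h v} \<in> {2, 3}" for v using assms by auto
  moreover have "?h v \<rightarrow>\<^bsub>double_star k\<^esub> v" if "v \<in> ?V" "?h v \<noteq> v" for v
    using that unfolding V double_star_dominates by (auto simp: Let_def split: if_splits)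
  ultimately show "star_partition ?V (\<lambda>x y. x \<rightarrow>\<^bsub>double_star k\<^esub> y) ?h"
    unfolding star_partition_def V by auto
qed

lemma double_star_isolated: "num_isolated (remove_verts (double_star k) {0, 1}) = 2 * k"
proof -
  have "isolated_outside (verts (double_star k)) (\<lambda>x y. x \<rightarrow>\<^bsub>double_star k\<^esub> y) {0, 1} = {2..<2 * k + 2}"
    unfolding double_star_dominates by (auto simp: double_star_def Let_def)
  then show ?thesis by (simp add: num_isolated_remove_verts[OF graph_double_star])
qed

text \<open>Deleting \<open>{0, 1}\<close> isolates all \<open>2 * k\<close> leaves:
  \<open>k = 1\<close> attains the lower bound 2 and \<open>k = 2\<close> the upper bound 4. The
  same set excludes a factor through the edge by the equivalence.\<close>

lemma double_star_extremal:
  assumes k: "k \<in> {1, 2}"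
  obtains G :: "(nat, nat \<times> nat) pre_digraph" and u v S
  where "graph G" "\<exists>F. star_circuit_factor F G" "u \<rightarrow>\<^bsub>G\<^esub> v"
    "\<nexists>F. star_circuit_factor F G \<and> u \<rightarrow>\<^bsub>F\<^esub> v"
    "S \<subseteq> verts G" "u \<in> S" "v \<in> S" "card S = 2" "num_isolated (remove_verts G S) = 2 * k"
proof
  let ?G = "double_star k"
  show edge: "0 \<rightarrow>\<^bsub>?G\<^esub> 1" by (simp add: double_star_dominates Let_def)
  show sub: "{0, 1} \<subseteq> verts ?G" by (simp add: double_star_def Let_def)
  have card: "card {0, 1 :: nat} = 2" by simp
  have "2 * int (card {0, 1 :: nat}) - 2 \<le> int (num_isolated (remove_verts ?G {0, 1}))"
    "int (num_isolated (remove_verts ?G {0, 1})) \<le> 2 * int (card {0, 1 :: nat})"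
    unfolding double_star_isolated card using k by auto
  then show "\<nexists>F. star_circuit_factor F ?G \<and> 0 \<rightarrow>\<^bsub>F\<^esub> 1"
    unfolding no_star_circuit_factor_containing_iff[OF graph_double_star double_star_factor[OF k] edge]
    using sub by blast
  show "graph ?G" by (rule graph_double_star)
  show "\<exists>F. star_circuit_factor F ?G" using k by (rule double_star_factor)
  show "num_isolated (remove_verts ?G {0, 1}) = 2 * k" by (rule double_star_isolated)
  show "0 \<in> {0, 1 :: nat}" "1 \<in> {0, 1 :: nat}" "card {0, 1 :: nat} = 2" by simp_all
qed

theorem theorem2p13:
  shows
    "(\<forall>(G :: ('a,'b) pre_digraph) u v.
        graph G \<and> (\<exists>F. star_circuit_factor F G) \<and> u \<rightarrow>\<^bsub>G\<^esub> v \<longrightarrow>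
        ((\<nexists>F. star_circuit_factor F G \<and> u \<rightarrow>\<^bsub>F\<^esub> v) \<longleftrightarrow>
         (\<exists>S \<subseteq> verts G. u \<in> S \<and> v \<in> S \<and>
            2 * int (card S) - 2 \<le> int (num_isolated (remove_verts G S)) \<and>
            int (num_isolated (remove_verts G S)) \<le> 2 * int (card S))))
   \<and> (\<exists>(G :: (nat, nat \<times> nat) pre_digraph) u v S.
        graph G \<and> (\<exists>F. star_circuit_factor F G) \<and> u \<rightarrow>\<^bsub>G\<^esub> v \<and>
        (\<nexists>F. star_circuit_factor F G \<and> u \<rightarrow>\<^bsub>F\<^esub> v) \<and>
        S \<subseteq> verts G \<and> u \<in> S \<and> v \<in> S \<and>
        2 * int (card S) - 2 = int (num_isolated (remove_verts G S)) \<and>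
        int (num_isolated (remove_verts G S)) \<le> 2 * int (card S))
   \<and> (\<exists>(G :: (nat, nat \<times> nat) pre_digraph) u v S.
        graph G \<and> (\<exists>F. star_circuit_factor F G) \<and> u \<rightarrow>\<^bsub>G\<^esub> v \<and>
        (\<nexists>F. star_circuit_factor F G \<and> u \<rightarrow>\<^bsub>F\<^esub> v) \<and>
        S \<subseteq> verts G \<and> u \<in> S \<and> v \<in> S \<and>
        2 * int (card S) - 2 \<le> int (num_isolated (remove_verts G S)) \<and>
        int (num_isolated (remove_verts G S)) = 2 * int (card S))"
proof (intro conjI allI impI)
  show "(\<nexists>F. star_circuit_factor F G \<and> u \<rightarrow>\<^bsub>F\<^esub> v) \<longleftrightarrow>
         (\<exists>S \<subseteq> verts G. u \<in> S \<and> v \<in> S \<and>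
            2 * int (card S) - 2 \<le> int (num_isolated (remove_verts G S)) \<and>
            int (num_isolated (remove_verts G S)) \<le> 2 * int (card S))"
    if "graph G \<and> (\<exists>F. star_circuit_factor F G) \<and> u \<rightarrow>\<^bsub>G\<^esub> v"
    for G :: "('a, 'b) pre_digraph" and u v
  proof -
    have "graph G" "\<exists>F. star_circuit_factor F G" "u \<rightarrow>\<^bsub>G\<^esub> v"
      using that by blast+
    then show ?thesis by (rule no_star_circuit_factor_containing_iff)
  qed
next
  show "\<exists>(G :: (nat, nat \<times> nat) pre_digraph) u v S.
        graph G \<and> (\<exists>F. star_circuit_factor F G) \<and> u \<rightarrow>\<^bsub>G\<^esub> v \<and>
        (\<nexists>F. star_circuit_factor F G \<and> u \<rightarrow>\<^bsub>F\<^esub> v) \<and>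
        S \<subseteq> verts G \<and> u \<in> S \<and> v \<in> S \<and>
        2 * int (card S) - 2 = int (num_isolated (remove_verts G S)) \<and>
        int (num_isolated (remove_verts G S)) \<le> 2 * int (card S)"
  proof (rule double_star_extremal[of 1])
    fix G :: "(nat, nat \<times> nat) pre_digraph" and u v S
    assume *: "graph G" "\<exists>F. star_circuit_factor F G" "u \<rightarrow>\<^bsub>G\<^esub> v"
      "\<nexists>F. star_circuit_factor F G \<and> u \<rightarrow>\<^bsub>F\<^esub> v"
      "S \<subseteq> verts G" "u \<in> S" "v \<in> S" "card S = 2" "num_isolated (remove_verts G S) = 2 * 1"
    show ?thesis
      by (rule exI[of _ G], rule exI[of _ u], rule exI[of _ v], rule exI[of _ S], intro conjI *(1-7))
        (simp_all add: *(8,9))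
  qed simp
next
  show "\<exists>(G :: (nat, nat \<times> nat) pre_digraph) u v S.
        graph G \<and> (\<exists>F. star_circuit_factor F G) \<and> u \<rightarrow>\<^bsub>G\<^esub> v \<and>
        (\<nexists>F. star_circuit_factor F G \<and> u \<rightarrow>\<^bsub>F\<^esub> v) \<and>
        S \<subseteq> verts G \<and> u \<in> S \<and> v \<in> S \<and>
        2 * int (card S) - 2 \<le> int (num_isolated (remove_verts G S)) \<and>
        int (num_isolated (remove_verts G S)) = 2 * int (card S)"
  proof (rule double_star_extremal[of 2])
    fix G :: "(nat, nat \<times> nat) pre_digraph" and u v S
    assume *: "graph G" "\<exists>F. star_circuit_factor F G" "u \<rightarrow>\<^bsub>G\<^esub> v"
      "\<nexists>F. star_circuit_factor F G \<and> u \<rightarrow>\<^bsub>F\<^esub> v"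
      "S \<subseteq> verts G" "u \<in> S" "v \<in> S" "card S = 2" "num_isolated (remove_verts G S) = 2 * 2"
    show ?thesis
      by (rule exI[of _ G], rule exI[of _ u], rule exI[of _ v], rule exI[of _ S], intro conjI *(1-7))
        (simp_all add: *(8,9))
  qed simp
qed

end
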